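(* Let $N\ge 1$, $l\ge 1$, $m\ge 0$, $s\ge 0$ be integers, let $A\in\mathbb{R}^{N\times N}$, and let $\mathcal{L}_A$ be the Lyapunov operator $\mathcal{L}_A[X]=AX+XA^T$ on $\mathbb{R}^{N\times N}$, assumed invertible. Suppose that $2^{-s}\mathcal{L}_A\in\Omega_m$, i.e. $\rho\big(e^{-2^{-s}\mathcal{L}_A}T_{0,m}(2^{-s}\mathcal{L}_A)-I\big)<1$. Then the approximation $T_{l,m}(\mathcal{L}_A)$ generated by the scaling and squaring recursions with parameters $m$ and $s$ (described in the context) satisfies $$T_{l,m}(\mathcal{L}_A)=\mathcal{L}_A^{-l}\left(e^{\mathcal{L}_A+\Delta\mathcal{L}_A}-\sum_{j=0}^{l-1}\frac{\mathcal{L}_A^{j}}{j!}\right),$$ where $$\Delta\mathcal{L}_A:=2^s\,h_{m+l}(2^{-s}\mathcal{L}_A).$$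
   Context: Operators here are linear maps $\mathbb{R}^{N\times N}\to\mathbb{R}^{N\times N}$; products and powers denote composition, $I$ is the identity operator (and the zeroth power), $e^{\mathcal{M}}=\sum_{k\ge0}\mathcal{M}^k/k!$, and $\rho$ denotes the spectral radius. $\mathrm{Lyap}(N)$ is the set of all Lyapunov operators $\mathcal{L}_B[X]=BX+XB^T$ with $B\in\mathbb{R}^{N\times N}$; note that $2^{-s}\mathcal{L}_A=\mathcal{L}_{2^{-s}A}$. For fixed integers $l\ge1$, $m\ge0$ and $\mathcal{L}\in\mathrm{Lyap}(N)$ put $$T_{0,m}(\mathcal{L})=\sum_{k=0}^{m+l}\frac{\mathcal{L}^k}{k!},$$ $$\Omega_m=\{\mathcal{L}\in\mathrm{Lyap}(N):\ \rho(e^{-\mathcal{L}}T_{0,m}(\mathcal{L})-I)<1\},$$ and, for $\mathcal{L}\in\Omega_m$, $$h_{m+l}(\mathcal{L})=\log\big(e^{-\mathcal{L}}T_{0,m}(\mathcal{L})\big),$$ where $\log$ is the principal logarithm. Scaling and squaring recursions. Given $A$, $m$, $s$, $l$, set $\mathcal{L}:=2^{-s}\mathcal{L}_A$. The initial operators are $$T_{l,m}(\mathcal{L})=\sum_{k=0}^{m}\frac{1}{(k+l)!}\mathcal{L}^k,\qquad T_{j,m}(\mathcal{L})=\mathcal{L}\,T_{j+1,m}(\mathcal{L})+\frac{1}{j!}I,\quad j=l-1,l-2,\dots,1.$$ Then, for $k=1,\dots,s$ and $1\le i\le l$, operators denoted $T_{i,m}(2^k\mathcal{L})$ are defined recursively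 by $$T_{i,m}(2^k\mathcal{L})=\frac{1}{2^i}\left(\big(T_{0,m}(\mathcal{L})\big)^{2^{k-1}}\,T_{i,m}(2^{k-1}\mathcal{L})+\sum_{j=1}^{i}\frac{1}{(i-j)!}\,T_{j,m}(2^{k-1}\mathcal{L})\right).$$ For $k\ge1$ the symbol $T_{i,m}(2^k\mathcal{L})$ means the operator produced by this recursion, not the truncated Taylor polynomial evaluated at $2^k\mathcal{L}$. The output, denoted $T_{l,m}(\mathcal{L}_A)$, is the operator $T_{l,m}(2^s\mathcal{L})$ obtained at $k=s$ (for $s=0$ it is the initial operator $T_{l,m}(\mathcal{L})$). *)

theory Defs
  imports "HOL-Analysis.Analysis"
begin

text \<open>
  Bounded linear operators of a space into itself, as a Banach algebra: multiplication is
  composition, \<open>1\<close> is the identity and the norm is the operator norm. A copy of the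
  type of bounded linear functions is needed because a class instance cannot force domain and
  codomain to agree. On \<open>real ^ 'n ^ 'n\<close> every linear map is bounded, so there this is the algebra
  of all linear maps, and \<open>exp\<close> and \<open>(^)\<close> are the operator exponential series and the
  compositional powers.
\<close>

typedef (overloaded) ('a::real_normed_vector) endo = "UNIV :: ('a \<Rightarrow>\<^sub>L 'a) set"
  morphisms blinfun_of_endo Endo ..

setup_lifting type_definition_endo

instantiation endo :: (real_normed_vector) real_normed_vector
begin

lift_definition zero_endo :: "'a endo" is 0 .
lift_definition plus_endo :: "'a endo \<Rightarrow> 'a endo \<Rightarrow> 'a endo" is "(+)" .
lift_definition minus_endo :: "'a endo \<Rightarrow> 'a endo \<Rightarrow> 'a endo" is "(-)" .
lift_definition uminus_endo :: "'a endo \<Rightarrow> 'a endo" is uminus .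
lift_definition scaleR_endo :: "real \<Rightarrow> 'a endo \<Rightarrow> 'a endo" is scaleR .
lift_definition norm_endo :: "'a endo \<Rightarrow> real" is norm .
definition dist_endo :: "'a endo \<Rightarrow> 'a endo \<Rightarrow> real" where
  "dist_endo f g = norm (f - g)"
definition sgn_endo :: "'a endo \<Rightarrow> 'a endo" where
  "sgn_endo f = scaleR (inverse (norm f)) f"
definition uniformity_endo :: "('a endo \<times> 'a endo) filter" where
  "uniformity_endo = (INF e\<in>{0<..}. principal {(x, y). dist x y < e})"
definition open_endo :: "'a endo set \<Rightarrow> bool" where
  "open_endo S = (\<forall>x\<in>S. \<forall>\<^sub>F (x', y) in uniformity. x' = x \<longrightarrow> y \<in> S)"

instance
proof
  show "open U = (\<forall>x\<in>U. \<forall>\<^sub>F (x', y) in uniformity. x' = x \<longrightarrow> y \<in> U)" for U :: "'a endo set"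
    by (rule open_endo_def)
qed (simp_all only: dist_endo_def sgn_endo_def uniformity_endo_def,
     (transfer, simp add: algebra_simps norm_triangle_ineq)+)

end

instantiation endo :: ("{real_normed_vector, perfect_space}") real_normed_algebra_1
begin

lift_definition one_endo :: "'a endo" is id_blinfun .
lift_definition times_endo :: "'a endo \<Rightarrow> 'a endo \<Rightarrow> 'a endo" is "(o\<^sub>L)" .

instance
proof
  fix a b c :: "'a endo" and r :: real
  show "a * b * c = a * (b * c)" by transfer (auto intro: blinfun_eqI)
  show "1 * a = a" by transfer (auto intro: blinfun_eqI)
  show "a * 1 = a" by transfer (auto intro: blinfun_eqI)
  show "(a + b) * c = a * c + b * c" by transfer (auto intro: blinfun_eqI simp: blinfun.bilinear_simps)
  show "a * (b + c) = a * b + a * c" by transfer (auto intro: blinfun_eqI simp: blinfun.bilinear_simps)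
  show "(r *\<^sub>R a) * b = r *\<^sub>R (a * b)" by transfer (auto intro: blinfun_eqI simp: blinfun.bilinear_simps)
  show "a * (r *\<^sub>R b) = r *\<^sub>R (a * b)" by transfer (auto intro: blinfun_eqI simp: blinfun.bilinear_simps)
  show "norm (a * b) \<le> norm a * norm b" by transfer (rule norm_blinfun_compose)
  show "norm (1 :: 'a endo) = 1" by transfer simp
  then show "(0 :: 'a endo) \<noteq> 1" by (metis norm_zero zero_neq_one)
qed

end

instance endo :: (banach) banach
proof
  fix X :: "nat \<Rightarrow> 'a endo"
  assume "Cauchy X"
  then have "Cauchy (\<lambda>n. blinfun_of_endo (X n))"
    unfolding Cauchy_def dist_norm by transfer
  then obtain L where "(\<lambda>n. blinfun_of_endo (X n)) \<longlonglongrightarrow> L"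
    by (auto simp: Cauchy_convergent_iff convergent_def)
  then have "(\<lambda>n. norm (blinfun_of_endo (X n) - L)) \<longlonglongrightarrow> 0"
    by (simp add: LIM_zero tendsto_norm_zero)
  then have "(\<lambda>n. norm (X n - Endo L)) \<longlonglongrightarrow> 0"
    by (simp add: norm_endo.rep_eq minus_endo.rep_eq Endo_inverse)
  then have "X \<longlonglongrightarrow> Endo L"
    by (rule LIM_zero_cancel[OF tendsto_norm_zero_cancel])
  then show "convergent X"
    by (auto simp: convergent_def)
qed

definition endo_apply :: "'a::real_normed_vector endo \<Rightarrow> 'a \<Rightarrow> 'a" where
  "endo_apply M = blinfun_apply (blinfun_of_endo M)"

definition endo_invertible :: "'a::real_normed_vector endo \<Rightarrow> bool" where
  "endo_invertible M \<longleftrightarrow> bij (endo_apply M)"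

text \<open>
  On a finite-dimensional space the inverse function of an invertible operator is bounded linear,
  so \<open>Blinfun\<close> is applied within its specified domain.
\<close>

definition endo_inverse :: "'a::real_normed_vector endo \<Rightarrow> 'a endo" where
  "endo_inverse M = Endo (Blinfun (inv (endo_apply M)))"

text \<open>
  Spectra of real operators are those of their complexifications. The pair \<open>(X, Y)\<close> represents
  \<open>X + \<i> Y\<close> in the complexification of \<open>'a\<close>, on which an operator acts componentwise.
\<close>

definition complex_scale :: "complex \<Rightarrow> 'a \<times> 'a \<Rightarrow> 'a \<times> ('a::real_vector)" where
  "complex_scale c Z =
    (Re c *\<^sub>R fst Z - Im c *\<^sub>R snd Z, Re c *\<^sub>R snd Z + Im c *\<^sub>R fst Z)"

definition eigenvalues :: "'a::real_normed_vector endo \<Rightarrow> complex set" where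
  "eigenvalues M =
    {c. \<exists>Z. Z \<noteq> 0 \<and> map_prod (endo_apply M) (endo_apply M) Z = complex_scale c Z}"

text \<open>Only used on finite-dimensional spaces, where the spectrum is the finite set of eigenvalues.\<close>

definition spectral_radius :: "'a::euclidean_space endo \<Rightarrow> real" where
  "spectral_radius M = Max (cmod ` eigenvalues M)"

text \<open>
  The principal logarithm: the unique logarithm all of whose eigenvalues lie in the open strip
  of imaginary parts between \<open>- pi\<close> and \<open>pi\<close>. It is sought among the real operators because
  the principal logarithm of a real operator without eigenvalues on the closed negative real
  axis is real.
\<close>

definition principal_log :: "'a::euclidean_space endo \<Rightarrow> 'a endo" where
  "principal_log M = (THE X. exp X = M \<and> (\<forall>c\<in>eigenvalues X. \<bar>Im c\<bar> < pi))"

definition lyapunov :: "real ^ 'n ^ 'n \<Rightarrow> (real ^ 'n ^ 'n) endo" where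
  "lyapunov B = Endo (Blinfun (\<lambda>X. B ** X + X ** transpose B))"

text \<open>\<open>Blinfun\<close> is unspecified on maps that are not bounded linear; \<open>lyapunov\<close> avoids this case.\<close>

lemma endo_apply_lyapunov: "endo_apply (lyapunov B) X = B ** X + X ** transpose B"
proof -
  have "linear (\<lambda>X. B ** X + X ** transpose B)"
    by (auto intro!: linearI simp: matrix_matrix_mult_def vec_eq_iff algebra_simps
        sum.distrib sum_distrib_left)
  then show ?thesis
    by (simp add: endo_apply_def lyapunov_def Endo_inverse bounded_linear_Blinfun_apply
        linear_conv_bounded_linear)
qed

definition T0 :: "nat \<Rightarrow> nat \<Rightarrow> 'a::euclidean_space endo \<Rightarrow> 'a endo" where
  "T0 l m L = (\<Sum>k\<le>m + l. L ^ k /\<^sub>R fact k)"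

definition Omega :: "nat \<Rightarrow> nat \<Rightarrow> (real ^ 'n ^ 'n) endo set" where
  "Omega l m = {L \<in> range lyapunov. spectral_radius (exp (- L) * T0 l m L - 1) < 1}"

text \<open>\<open>h_log l m\<close> is the function $h_{m+l}$.\<close>

definition h_log :: "nat \<Rightarrow> nat \<Rightarrow> 'a::euclidean_space endo \<Rightarrow> 'a endo" where
  "h_log l m L = principal_log (exp (- L) * T0 l m L)"

definition Delta :: "nat \<Rightarrow> nat \<Rightarrow> nat \<Rightarrow> 'a::euclidean_space endo \<Rightarrow> 'a endo" where
  "Delta l m s L = 2 ^ s *\<^sub>R h_log l m (L /\<^sub>R 2 ^ s)"

text \<open>The initial operators; meaningful for \<open>1 \<le> j \<le> l\<close>.\<close>

function T_init :: "nat \<Rightarrow> nat \<Rightarrow> 'a::euclidean_space endo \<Rightarrow> nat \<Rightarrow> 'a endo" where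
  "T_init l m L j =
    (if j < l then L * T_init l m L (Suc j) + 1 /\<^sub>R fact j
     else \<Sum>k\<le>m. L ^ k /\<^sub>R fact (k + l))"
  by auto
termination by (relation "Wellfounded.measure (\<lambda>(l, m, L, j). l - j)") auto

declare T_init.simps [simp del]

text \<open>\<open>T_rec l m L k i\<close> is the operator that the recursion calls $T_{i,m}(2^k L)$.\<close>

primrec T_rec :: "nat \<Rightarrow> nat \<Rightarrow> 'a::euclidean_space endo \<Rightarrow> nat \<Rightarrow> nat \<Rightarrow> 'a endo" where
  "T_rec l m L 0 = T_init l m L"
| "T_rec l m L (Suc k) = (\<lambda>i.
    (T0 l m L ^ (2 ^ k) * T_rec l m L k i + (\<Sum>j = 1..i. T_rec l m L k j /\<^sub>R fact (i - j))) /\<^sub>R 2 ^ i)"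

definition T_output :: "nat \<Rightarrow> nat \<Rightarrow> nat \<Rightarrow> 'a::euclidean_space endo \<Rightarrow> 'a endo" where
  "T_output l m s L = T_rec l m (L /\<^sub>R 2 ^ s) s l"

end

(*
  Left multiplication by L^i turns the recursion for the operators T_i into the identity
  (2^k L)^i T_i(2^k L) = T_0(L)^(2^k) - sum_{j<i} (2^k L)^j / j!, because the sum over j in the
  recursion is a Cauchy product of truncated exponential series. It remains to see that
  T_0(2^-s L)^(2^s) = exp (L + Delta L), i.e. that the principal logarithm of
  M = exp (-2^-s L) T_0(2^-s L) exists, is unique, and commutes with everything that commutes
  with M. With E = M - 1 it is the integral of E (1 + u E)^-1 over u in [0, 1], which avoids
  estimates for the power series. Eigenvalues of the logarithm are located, and uniqueness is
  proved, with common eigenvectors of commuting operators in invariant sets of the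
  complexification.
*)

theory Submission
  imports Defs "HOL-Computational_Algebra.Fundamental_Theorem_Algebra"
begin

subsection \<open>The algebra of bounded operators\<close>

lemma endo_apply_add_left: "endo_apply (M + N) x = endo_apply M x + endo_apply N x"
  by (simp add: endo_apply_def plus_endo.rep_eq blinfun.add_left)

lemma endo_apply_diff_left: "endo_apply (M - N) x = endo_apply M x - endo_apply N x"
  by (simp add: endo_apply_def minus_endo.rep_eq blinfun.diff_left)

lemma endo_apply_scaleR_left: "endo_apply (r *\<^sub>R M) x = r *\<^sub>R endo_apply M x"
  by (simp add: endo_apply_def scaleR_endo.rep_eq blinfun.scaleR_left)

lemma endo_apply_one: "endo_apply 1 x = x"
  by (simp add: endo_apply_def one_endo.rep_eq)

lemma endo_apply_mult: "endo_apply (M * N) x = endo_apply M (endo_apply N x)"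
  by (simp add: endo_apply_def times_endo.rep_eq)

lemmas endo_apply_simps = endo_apply_add_left endo_apply_diff_left endo_apply_scaleR_left
  endo_apply_one endo_apply_mult

lemma bounded_linear_endo_apply: "bounded_linear (endo_apply M)"
  unfolding endo_apply_def by (rule blinfun.bounded_linear_right)

lemma norm_endo_apply: "norm (endo_apply M x) \<le> norm M * norm x"
  by (simp add: endo_apply_def norm_endo.rep_eq norm_blinfun)

lemma bounded_linear_endo_apply_left: "bounded_linear (\<lambda>M. endo_apply M x)"
  by (rule bounded_linear_intro[where K = "norm x"])
     (auto simp: endo_apply_simps norm_endo_apply)

lemma endo_eqI: "(\<And>x. endo_apply M x = endo_apply N x) \<Longrightarrow> M = N"
  by (simp add: endo_apply_def blinfun_eqI blinfun_of_endo_inject[symmetric])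

lemma
  fixes M :: "'a::euclidean_space endo"
  assumes "endo_invertible M"
  shows endo_inverse_left: "endo_inverse M * M = 1"
    and endo_inverse_right: "M * endo_inverse M = 1"
proof -
  have bij: "bij (endo_apply M)"
    using assms by (simp add: endo_invertible_def)
  have "linear (inv (endo_apply M))"
    using bij bounded_linear_endo_apply[of M]
    by (intro inj_linear_imp_inv_linear) (auto simp: bij_def bounded_linear.linear)
  then have app: "endo_apply (endo_inverse M) x = inv (endo_apply M) x" for x
    unfolding endo_inverse_def endo_apply_def[of "Endo _"]
    by (simp add: Endo_inverse bounded_linear_Blinfun_apply linear_conv_bounded_linear)
  show "endo_inverse M * M = 1" "M * endo_inverse M = 1"
    using bij by (auto intro!: endo_eqI simp: endo_apply_simps app bij_is_inj bij_is_surj surj_f_inv_f)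
qed

lemma endo_invertibleI:
  fixes M :: "'a::euclidean_space endo"
  assumes "\<And>x. endo_apply M x = 0 \<Longrightarrow> x = 0"
  shows "endo_invertible M"
proof -
  have lin: "linear (endo_apply M)"
    by (simp add: bounded_linear_endo_apply bounded_linear.linear)
  then have "inj (endo_apply M)"
    using assms linear_injective_0 by blast
  with lin show ?thesis
    unfolding endo_invertible_def bij_def using linear_injective_imp_surjective by blast
qed

subsection \<open>Eigenvectors in the complexification\<close>

text \<open>Names the componentwise action that is written out in \<open>eigenvalues\<close>, so
  that linearity and commutation rules can be stated for it.\<close>

definition complexify :: "'a::real_normed_vector endo \<Rightarrow> 'a \<times> 'a \<Rightarrow> 'a \<times> 'a" where
  "complexify M = map_prod (endo_apply M) (endo_apply M)"

lemma complexify_simps: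
  "complexify (M + N) Z = complexify M Z + complexify N Z"
  "complexify (M - N) Z = complexify M Z - complexify N Z"
  "complexify (r *\<^sub>R M) Z = r *\<^sub>R complexify M Z"
  by (auto simp: complexify_def map_prod_def endo_apply_simps plus_prod_def minus_prod_def
      scaleR_prod_def split: prod.splits)

lemma complexify_one: "complexify 1 Z = Z"
  by (auto simp: complexify_def map_prod_def endo_apply_simps split: prod.splits)

lemma complexify_mult: "complexify (M * N) Z = complexify M (complexify N Z)"
  by (auto simp: complexify_def map_prod_def endo_apply_simps split: prod.splits)

lemma bounded_linear_complexify: "bounded_linear (complexify M)"
  unfolding complexify_def map_prod_def case_prod_beta
  by (intro bounded_linear_Pair bounded_linear_compose[OF bounded_linear_endo_apply]
      bounded_linear_fst bounded_linear_snd)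

text \<open>Evaluation at a fixed vector is continuous in the operator; this carries exponential
  series and integrals of operators over to vectors.\<close>

lemma bounded_linear_complexify_left: "bounded_linear (\<lambda>M. complexify M Z)"
  unfolding complexify_def map_prod_def case_prod_beta
  by (intro bounded_linear_Pair bounded_linear_endo_apply_left)

text \<open>The product type carries only its real vector space structure, so the complex module
  laws are stated by hand.\<close>

lemma complex_scale_simps:
  "complex_scale (a + b) Z = complex_scale a Z + complex_scale b Z"
  "complex_scale (a - b) Z = complex_scale a Z - complex_scale b Z"
  "complex_scale (- a) Z = - complex_scale a Z"
  "complex_scale a (Z + W) = complex_scale a Z + complex_scale a W"
  "complex_scale a (Z - W) = complex_scale a Z - complex_scale a W"
  "complex_scale a (r *\<^sub>R Z) = r *\<^sub>R complex_scale a Z"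
  "complex_scale (r *\<^sub>R a) Z = r *\<^sub>R complex_scale a Z"
  "complex_scale (a * b) Z = complex_scale a (complex_scale b Z)"
  "complex_scale 1 Z = Z" "complex_scale 0 Z = 0" "complex_scale a 0 = 0"
  by (auto simp: complex_scale_def plus_prod_def minus_prod_def uminus_prod_def scaleR_prod_def
      zero_prod_def algebra_simps split: prod.splits)

lemma complex_scale_eq_0_iff: "complex_scale a Z = 0 \<longleftrightarrow> a = 0 \<or> Z = 0"
proof
  assume *: "complex_scale a Z = 0"
  have "Z = 0" if "a \<noteq> 0"
  proof -
    have "complex_scale (inverse a * a) Z = 0"
      using * by (simp only: complex_scale_simps)
    with that show ?thesis by (simp add: complex_scale_simps)
  qed
  then show "a = 0 \<or> Z = 0" by blast
qed (auto simp: complex_scale_simps)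

lemma complex_scale_of_real: "complex_scale (of_real r) Z = r *\<^sub>R Z"
  by (simp add: complex_scale_def scaleR_prod_def)

lemma bounded_linear_complex_scale_left:
  "bounded_linear (\<lambda>c. complex_scale c (Z :: 'a::real_normed_vector \<times> 'a))"
  unfolding complex_scale_def
  by (intro bounded_linear_Pair bounded_linear_add bounded_linear_sub
      bounded_linear_compose[OF bounded_linear_scaleR_left] bounded_linear_Re bounded_linear_Im)

lemma complexify_complex_scale:
  "complexify M (complex_scale c Z) = complex_scale c (complexify M Z)"
  using linear_simps[OF bounded_linear_endo_apply[of M]]
  by (auto simp: complexify_def complex_scale_def map_prod_def split: prod.splits)

lemmas complexify_right = linear_simps[OF bounded_linear_complexify]

lemma eigenvalues_iff: "c \<in> eigenvalues M \<longleftrightarrow> (\<exists>Z. Z \<noteq> 0 \<and> complexify M Z = complex_scale c Z)"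
  by (auto simp: eigenvalues_def complexify_def)

lemma eigenvaluesE:
  assumes "c \<in> eigenvalues M"
  obtains Z where "Z \<noteq> 0" "complexify M Z = complex_scale c Z"
  using assms[unfolded eigenvalues_iff] by (elim exE conjE)

text \<open>The value at \<open>Z\<close> of the polynomial \<open>p\<close> evaluated at the complexified operator.\<close>

definition complex_poly :: "'a::real_normed_vector endo \<Rightarrow> complex poly \<Rightarrow> 'a \<times> 'a \<Rightarrow> 'a \<times> 'a" where
  "complex_poly M p Z = fold_coeffs (\<lambda>a W. complex_scale a Z + complexify M W) p 0"

lemma complex_poly_0: "complex_poly M 0 Z = 0"
  by (simp add: complex_poly_def)

lemma complex_poly_pCons:
  "complex_poly M (pCons a p) Z = complex_scale a Z + complexify M (complex_poly M p Z)"
  by (cases "p = 0 \<and> a = 0") (auto simp: complex_poly_def complex_scale_simps complexify_right)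

lemma complex_poly_add: "complex_poly M (p + q) Z = complex_poly M p Z + complex_poly M q Z"
  by (induction p q rule: poly_induct2)
     (auto simp: complex_poly_0 complex_poly_pCons complex_scale_simps complexify_right)

lemma complex_poly_smult: "complex_poly M (smult c p) Z = complex_scale c (complex_poly M p Z)"
  by (induction p)
     (auto simp: complex_poly_0 complex_poly_pCons complex_scale_simps complexify_complex_scale)

lemma complex_poly_mult: "complex_poly M (p * q) Z = complex_poly M p (complex_poly M q Z)"
  by (induction p)
     (auto simp: complex_poly_0 complex_poly_pCons complex_poly_add complex_poly_smult
       complex_scale_simps)

lemma complex_poly_monom:
  fixes M :: "'a::{real_normed_vector, perfect_space} endo"
  shows "complex_poly M (monom a n) Z = complex_scale a (complexify (M ^ n) Z)"
  by (induction n)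
     (auto simp: complex_poly_0 complex_poly_pCons complexify_mult complexify_one monom_0 monom_Suc
       complex_scale_simps complexify_complex_scale complexify_right)

lemma linear_complex_poly: "linear (complex_poly M p)"
  by (induction p; intro linearI)
     (auto simp: complex_poly_0 complex_poly_pCons complexify_right linear_add linear_scale
       complex_scale_simps scaleR_right_distrib)

lemma complex_poly_eigenvector:
  "complexify M Z = complex_scale c Z \<Longrightarrow> complex_poly M p Z = complex_scale (poly p c) Z"
  by (induction p)
     (auto simp: complex_poly_0 complex_poly_pCons complex_scale_simps complexify_complex_scale
       mult.commute[of c])

section \<open>Annihilating polynomials, finiteness of the spectrum, eigenvectors in invariant
  sets\<close>

text \<open>The iterates \<open>M ^ i\<close> on \<open>Z\<close> for \<open>i\<close> up to the
  real dimension are one too many to be independent; a real dependence between them supplies the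
  coefficients.\<close>

lemma complex_poly_annihilates_vector:
  fixes M :: "'a::euclidean_space endo"
  shows "\<exists>p. p \<noteq> 0 \<and> complex_poly M p Z = 0"
proof (rule ccontr)
  assume "\<not> ?thesis"
  then have inj: "p = 0" if "complex_poly M p Z = 0" for p
    using that by blast
  define v where "v i = complexify (M ^ i) Z" for i
  let ?I = "{..DIM('a \<times> 'a)}"
  \<comment> \<open>A repeated iterate would make the set of iterates too small for the dimension
    count. It already gives an annihilating difference of two monomials, so it is excluded
    first.\<close>
  have "i = j" if "v i = v j" for i j
  proof -
    have "complex_poly M (monom 1 i + monom (- 1) j) Z = 0"
      using that by (simp add: complex_poly_add complex_poly_monom complex_scale_simps v_def)
    from inj[OF this] have "coeff (monom 1 i + monom (- 1) j) i = (0 :: complex)" by simp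
    then show ?thesis by (auto split: if_splits)
  qed
  then have inj_v: "inj_on v ?I" by (auto simp: inj_on_def)
  then have "card (v ` ?I) > DIM('a \<times> 'a)" by (simp add: card_image)
  then have "dependent (v ` ?I)" by (intro dependent_biggerset) auto
  then have "\<exists>u. (\<exists>w\<in>v ` ?I. u w \<noteq> 0) \<and> (\<Sum>w\<in>v ` ?I. u w *\<^sub>R w) = 0"
    by (subst (asm) dependent_finite) auto
  then obtain u w where u: "w \<in> v ` ?I" "u w \<noteq> 0" "(\<Sum>w\<in>v ` ?I. u w *\<^sub>R w) = 0"
    by blast
  then obtain k where k: "k \<in> ?I" "w = v k" by blast
  define p where "p = (\<Sum>i\<in>?I. monom (complex_of_real (u (v i))) i)"
  have "complex_poly M (\<Sum>i\<in>J. monom (complex_of_real (u (v i))) i) Z = (\<Sum>i\<in>J. u (v i) *\<^sub>R v i)"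
    if "finite J" for J
    using that
    by induction (auto simp: complex_poly_0 complex_poly_add complex_poly_monom
        complex_scale_of_real v_def)
  with u(3) have "complex_poly M p Z = 0"
    by (simp add: p_def sum.reindex[OF inj_v] del: DIM_prod)
  from inj[OF this] have "coeff p k = 0" by simp
  moreover have "coeff p k = u (v k)"
    using k(1) by (simp add: p_def coeff_sum)
  ultimately show False using u(2) k(2) by simp
qed

text \<open>Multiplying annihilating polynomials of the basis vectors gives one polynomial that
  kills the whole space, and every eigenvalue is a root of it. Finiteness is what makes
  \<open>Max\<close> in \<open>spectral_radius\<close> an upper bound.\<close>

lemma finite_eigenvalues:
  fixes M :: "'a::euclidean_space endo"
  shows "finite (eigenvalues M)"
proof -
  have "\<exists>p. p \<noteq> 0 \<and> (\<forall>Z\<in>B. complex_poly M p Z = 0)" if "finite B" for B :: "('a \<times> 'a) set"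
    using that
  proof induction
    case (insert Z B)
    then obtain p where p: "p \<noteq> 0" "\<forall>Z\<in>B. complex_poly M p Z = 0" by blast
    obtain q where q: "q \<noteq> 0" "complex_poly M q Z = 0"
      using complex_poly_annihilates_vector by blast
    \<comment> \<open>The right factor acts first, so the two orders of the commutative product
      serve \<open>Z\<close> and the vectors of \<open>B\<close> respectively.\<close>
    have "complex_poly M (p * q) Z = 0"
      using q linear_0[OF linear_complex_poly] by (simp add: complex_poly_mult)
    moreover have "complex_poly M (q * p) W = 0" if "W \<in> B" for W
      using p that linear_0[OF linear_complex_poly] by (simp add: complex_poly_mult)
    ultimately show ?case
      using p q by (intro exI[of _ "p * q"]) (auto simp: mult.commute)
  qed (auto intro: exI[of _ 1])
  from this[OF finite_Basis] obtain p
    where p: "p \<noteq> 0" "\<forall>Z\<in>Basis. complex_poly M p Z = 0" by blast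
  have ann: "complex_poly M p Z = 0" for Z
    using linear_eq_0_on_span[OF linear_complex_poly, of Basis M p Z] p by auto
  have "poly p c = 0" if c: "c \<in> eigenvalues M" for c
  proof -
    obtain Z where "Z \<noteq> 0" "complexify M Z = complex_scale c Z"
      using c by (rule eigenvaluesE)
    with ann[of Z] show ?thesis
      by (simp add: complex_poly_eigenvector complex_scale_eq_0_iff)
  qed
  then show ?thesis
    by (intro finite_subset[OF _ poly_roots_finite[OF p(1)]]) blast
qed

lemma eigenvalue_less_spectral_radius:
  assumes "spectral_radius M < r" "c \<in> eigenvalues M"
  shows "cmod c < r"
proof -
  have "cmod c \<le> spectral_radius M"
    unfolding spectral_radius_def using assms(2) by (intro Max_ge) (auto simp: finite_eigenvalues)
  then show ?thesis using assms(1) by simp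
qed

text \<open>Induction on the degree of a polynomial that kills \<open>Z\<close>: for a root
  \<open>c\<close>, either \<open>Z\<close> is an eigenvector, or \<open>M - c\<close> sends it to a
  nonzero element of \<open>S\<close> killed by the quotient of smaller degree. Closure of
  \<open>S\<close> under every \<open>M - c\<close> suffices, so no operator has to be restricted to
  a subspace.\<close>

lemma eigenvector_in_invariant_set:
  fixes M :: "'a::euclidean_space endo"
  assumes "Z \<in> S" "Z \<noteq> 0"
    and inv: "\<And>c Z. Z \<in> S \<Longrightarrow> complexify M Z - complex_scale c Z \<in> S"
  obtains c W where "W \<in> S" "W \<noteq> 0" "complexify M W = complex_scale c W"
proof -
  obtain p where "p \<noteq> 0" "complex_poly M p Z = 0"
    using complex_poly_annihilates_vector by blast
  with assms(1,2) have "\<exists>c W. W \<in> S \<and> W \<noteq> 0 \<and> complexify M W = complex_scale c W"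
  proof (induction "degree p" arbitrary: p Z)
    \<comment> \<open>A nonzero constant kills only the zero vector, so this case contradicts the
      choice of \<open>Z\<close>.\<close>
    case 0
    then obtain a where "p = [:a:]" using degree_0_id[of p] by metis
    with 0 show ?case
      by (simp add: complex_poly_pCons complex_poly_0 complexify_right complex_scale_eq_0_iff)
  next
    case (Suc n)
    then obtain c where "poly p c = 0"
      using fundamental_theorem_of_algebra_alt[of p] by (metis degree_pCons_0 nat.distinct(1))
    then obtain q where p: "p = [:- c, 1:] * q"
      by (metis dvdE poly_eq_0_iff_dvd)
    define W where "W = complexify M Z - complex_scale c Z"
    show ?case
    proof (cases "W = 0")
      case True
      with Suc.prems show ?thesis by (intro exI[of _ c] exI[of _ Z]) (simp add: W_def)
    next
      case False
      have "q \<noteq> 0" using Suc.prems p by auto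
      then have "degree q = n"
        using Suc.hyps(2) unfolding p by (subst (asm) degree_mult_eq) auto
      moreover have "complex_poly M (q * [:- c, 1:]) Z = 0"
        using Suc.prems p by (simp add: mult.commute)
      then have "complex_poly M q W = 0"
        by (simp only: complex_poly_mult)
           (simp add: complex_poly_pCons complex_poly_0 complexify_right complex_scale_simps W_def)
      ultimately show ?thesis
        using Suc.hyps(1)[of q W] False \<open>q \<noteq> 0\<close> inv[OF Suc.prems(1)] by (auto simp: W_def)
    qed
  qed
  with that show ?thesis by blast
qed

text \<open>Since \<open>N\<close> commutes with \<open>M\<close>, it preserves the eigenspaces of
  \<open>M\<close>; the previous lemma is applied once to \<open>S\<close> and once to an eigenspace
  of \<open>M\<close> within \<open>S\<close>.\<close>

lemma common_eigenvector_in_invariant_set: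
  fixes M N :: "'a::euclidean_space endo"
  assumes comm: "M * N = N * M"
    and "Z \<in> S" "Z \<noteq> 0"
    and inv_M: "\<And>c Z. Z \<in> S \<Longrightarrow> complexify M Z - complex_scale c Z \<in> S"
    and inv_N: "\<And>c Z. Z \<in> S \<Longrightarrow> complexify N Z - complex_scale c Z \<in> S"
  obtains c d W where "W \<in> S" "W \<noteq> 0" "complexify M W = complex_scale c W"
    "complexify N W = complex_scale d W"
proof -
  obtain c W where W: "W \<in> S" "W \<noteq> 0" "complexify M W = complex_scale c W"
    using eigenvector_in_invariant_set[OF assms(2,3) inv_M] by blast
  have comm': "complexify M (complexify N Z) = complexify N (complexify M Z)" for Z
    using comm by (metis complexify_mult)
  let ?S = "{Z \<in> S. complexify M Z = complex_scale c Z}"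
  have "complexify N Z - complex_scale d Z \<in> ?S" if "Z \<in> ?S" for d Z
    using that inv_N
    by (simp add: complexify_right comm' complexify_complex_scale complex_scale_simps
        flip: complex_scale_simps(8)) (simp add: mult.commute)
  from eigenvector_in_invariant_set[OF _ W(2) this] W that show ?thesis by blast
qed

subsection \<open>The principal logarithm\<close>

text \<open>The terms of order two and higher are dominated by those of the real series at
  \<open>norm h\<close>, whose sum is at most the square of \<open>norm h\<close> on the unit
  ball.\<close>

lemma exp_has_derivative_at_0:
  "(exp has_derivative (\<lambda>h. h)) (at (0 :: 'a::{real_normed_algebra_1, banach}))"
proof -
  have bound: "norm (exp h - 1 - h) / norm h \<le> norm h" if "norm h < 1" for h :: 'a
  proof -
    let ?g = "\<lambda>n. inverse (fact (n + 2)) *\<^sub>R norm h ^ (n + 2)"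
    have "norm (exp h - 1 - h) = norm (\<Sum>n. inverse (fact (n + 2)) *\<^sub>R h ^ (n + 2))"
      by (subst exp_first_two_terms) simp
    also have "\<dots> \<le> suminf ?g"
    proof (rule norm_suminf_le)
      show "norm (inverse (fact (n + 2)) *\<^sub>R h ^ (n + 2)) \<le> ?g n" for n
        using norm_power_ineq[of h "n + 2"] by (simp add: mult_left_mono)
      show "summable ?g"
        by (rule summable_ignore_initial_segment[OF summable_exp_generic])
    qed
    also have "\<dots> = exp (norm h) - 1 - norm h"
      by (subst exp_first_two_terms) simp
    also have "\<dots> \<le> norm h * norm h"
      using exp_bound[of "norm h"] that by (simp add: power2_eq_square)
    \<comment> \<open>At \<open>h = 0\<close> the quotient is 0, the value of division by
      zero.\<close>
    finally show ?thesis by (cases "h = 0") (auto simp: divide_simps)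
  qed
  have "((\<lambda>h::'a. norm (exp h - 1 - h) / norm h) \<longlongrightarrow> 0) (at 0)"
  proof (rule Lim_null_comparison)
    show "\<forall>\<^sub>F h :: 'a in at 0. norm (norm (exp h - 1 - h) / norm h) \<le> norm h"
      using bound by (auto simp: eventually_at intro!: exI[of _ 1])
    show "((\<lambda>h::'a. norm h) \<longlongrightarrow> 0) (at 0)"
      by (intro tendsto_norm_zero tendsto_ident_at)
  qed
  then show ?thesis by (simp add: has_derivative_at bounded_linear_ident)
qed

text \<open>Commutation splits \<open>exp (f s)\<close> into
  \<open>exp (f t) * exp (f s - f t)\<close>, so the derivative at the origin and the chain rule
  suffice.\<close>

lemma has_vector_derivative_exp_commuting:
  fixes f :: "real \<Rightarrow> 'a::{real_normed_algebra_1, banach}"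
  assumes f: "(f has_vector_derivative f') (at t within S)" and "t \<in> S"
    and comm: "\<And>s. s \<in> S \<Longrightarrow> f s * f t = f t * f s"
  shows "((\<lambda>s. exp (f s)) has_vector_derivative exp (f t) * f') (at t within S)"
proof -
  have "((\<lambda>s. f s - f t) has_derivative (\<lambda>h. h *\<^sub>R f')) (at t within S)"
    using f unfolding has_vector_derivative_def by (auto intro!: derivative_eq_intros)
  from has_derivative_compose[OF this] exp_has_derivative_at_0
  have "((\<lambda>s. exp (f s - f t)) has_vector_derivative f') (at t within S)"
    by (simp add: has_vector_derivative_def)
  from bounded_linear.has_vector_derivative[OF bounded_linear_mult_right[of "exp (f t)"] this]
  have "((\<lambda>s. exp (f t) * exp (f s - f t)) has_vector_derivative exp (f t) * f') (at t within S)" .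
  then show ?thesis
  proof (rule has_vector_derivative_transform[OF \<open>t \<in> S\<close>, rotated])
    fix s assume "s \<in> S"
    then have "exp (f t + (f s - f t)) = exp (f t) * exp (f s - f t)"
      using comm by (intro exp_add_commuting) (simp add: algebra_simps)
    then show "exp (f s) = exp (f t) * exp (f s - f t)" by simp
  qed
qed

text \<open>Rests on the resolvent identity \<open>R t - R s = R t * (P s - P t) * R s\<close>. No
  bound on \<open>R t\<close> is known beforehand; it is estimated by \<open>R s\<close> and the
  difference being bounded.\<close>

lemma continuous_on_two_sided_inverse:
  fixes P R :: "'b::topological_space \<Rightarrow> 'a::real_normed_algebra_1"
  assumes P: "continuous_on S P"
    and inv: "\<And>t. t \<in> S \<Longrightarrow> R t * P t = 1" "\<And>t. t \<in> S \<Longrightarrow> P t * R t = 1"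
  shows "continuous_on S R"
  unfolding continuous_on_def
proof
  fix s assume s: "s \<in> S"
  let ?r = "norm (R s)" and ?d = "\<lambda>t. norm (P s - P t)"
  have "((\<lambda>t. P s - P t) \<longlongrightarrow> P s - P s) (at s within S)"
    using P s by (intro tendsto_intros) (auto simp: continuous_on_def)
  then have d: "(?d \<longlongrightarrow> 0) (at s within S)"
    by (intro tendsto_norm_zero) simp
  have "((\<lambda>t. R t - R s) \<longlongrightarrow> 0) (at s within S)"
  proof (rule Lim_null_comparison)
    show "((\<lambda>t. 2 * ?r\<^sup>2 * ?d t) \<longlongrightarrow> 0) (at s within S)"
      by (rule tendsto_mult_right_zero[OF d])
    have "\<forall>\<^sub>F t in at s within S. ?d t * ?r < 1 / 2"
      by (rule order_tendstoD[OF tendsto_mult_left_zero[OF d]]) simp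
    moreover have "\<forall>\<^sub>F t in at s within S. t \<in> S"
      by (simp add: eventually_at_filter)
    ultimately show "\<forall>\<^sub>F t in at s within S. norm (R t - R s) \<le> 2 * ?r\<^sup>2 * ?d t"
    proof eventually_elim
      case (elim t)
      have "R t * (P s - P t) * R s = R t * (P s * R s) - (R t * P t) * R s"
        by (simp add: algebra_simps)
      then have "R t - R s = R t * (P s - P t) * R s"
        using inv s elim by simp
      then have "norm (R t - R s) \<le> norm (R t * (P s - P t)) * ?r"
        by (simp add: norm_mult_ineq)
      also have "\<dots> \<le> norm (R t) * ?d t * ?r"
        by (intro mult_right_mono norm_mult_ineq) simp
      also have "\<dots> \<le> (norm (R t - R s) + ?r) * (?d t * ?r)"
        using norm_triangle_ineq[of "R t - R s" "R s"] unfolding mult.assoc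
        by (intro mult_right_mono) auto
      also have "\<dots> = norm (R t - R s) * (?d t * ?r) + ?r\<^sup>2 * ?d t"
        by (simp add: algebra_simps power2_eq_square)
      \<comment> \<open>Half of the left-hand side is absorbed here, whence the factor 2 in the
        majorant.\<close>
      also have "norm (R t - R s) * (?d t * ?r) \<le> norm (R t - R s) * (1 / 2)"
        using elim by (intro mult_left_mono) auto
      finally show ?case by simp
    qed
  qed
  then show "(R \<longlongrightarrow> R s) (at s within S)" by (rule LIM_zero_cancel)
qed

lemma commutes_with_exp:
  fixes A B :: "'a::{real_normed_algebra_1, banach}"
  assumes "A * B = B * A"
  shows "A * exp B = exp B * A"
proof -
  have "A * B ^ n = B ^ n * A" for n
    using power_commuting_commutes[of B A n] assms by simp
  then show ?thesis
    by (simp add: exp_def suminf_mult[symmetric] suminf_mult2 summable_exp_generic)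
qed

lemma commutes_with_inverse:
  fixes P R L :: "'a::monoid_mult"
  assumes "L * P = P * L" "R * P = 1" "P * R = 1"
  shows "L * R = R * L"
  by (metis assms mult.assoc mult_1_left mult_1_right)

section \<open>Existence of the logarithm\<close>

text \<open>The witness is \<open>F 1\<close>: the product \<open>P t * exp (- F t)\<close> has
  derivative zero and starts at 1. An eigenvalue of \<open>F 1\<close> has an eigenvector in common
  with \<open>E\<close>, on which the integral evaluates to \<open>Ln (1 + e)\<close> with
  \<open>e\<close> in the open unit disc.\<close>

lemma exists_principal_log:
  fixes E :: "'a::euclidean_space endo"
  assumes small: "\<And>c. c \<in> eigenvalues E \<Longrightarrow> cmod c < 1"
  obtains X where "exp X = 1 + E" "\<And>L. L * E = E * L \<Longrightarrow> L * X = X * L"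
    "\<And>c. c \<in> eigenvalues X \<Longrightarrow> \<bar>Im c\<bar> < pi"
proof -
  define P where "P t = 1 + t *\<^sub>R E" for t
  define R where "R t = endo_inverse (P t)" for t
  \<comment> \<open>A kernel vector of \<open>P t\<close> is a real eigenvector of \<open>E\<close>
    for \<open>- 1 / t\<close>, which has modulus at least 1.\<close>
  have "endo_invertible (P t)" if "t \<in> {0..1}" for t
  proof (rule endo_invertibleI)
    fix x assume x: "endo_apply (P t) x = 0"
    show "x = 0"
    proof (rule ccontr)
      assume "x \<noteq> 0"
      with x have t: "t \<noteq> 0" by (auto simp: P_def endo_apply_simps)
      have "t *\<^sub>R endo_apply E x = - x"
        using x by (simp add: P_def endo_apply_simps eq_neg_iff_add_eq_0 add.commute)
      then have "inverse t *\<^sub>R t *\<^sub>R endo_apply E x = inverse t *\<^sub>R - x" by simp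
      with t have "endo_apply E x = (- 1 / t) *\<^sub>R x"
        by (simp add: inverse_eq_divide)
      then have "complexify E (x, 0) = complex_scale (of_real (- 1 / t)) (x, 0)"
        unfolding complex_scale_of_real
        using linear_simps(3)[OF bounded_linear_endo_apply[of E]]
        by (simp add: complexify_def)
      moreover have "(x, 0) \<noteq> (0 :: 'a \<times> 'a)" using \<open>x \<noteq> 0\<close> by (simp add: zero_prod_def)
      ultimately have "of_real (- 1 / t) \<in> eigenvalues E"
        unfolding eigenvalues_iff by blast
      from small[OF this] show False using that t by (simp add: norm_divide divide_simps split: if_splits)
    qed
  qed
  then have inv: "R t * P t = 1" "P t * R t = 1" if "t \<in> {0..1}" for t
    using that by (simp_all add: R_def endo_inverse_left endo_inverse_right)
  have "continuous_on {0..1} P"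
    unfolding P_def by (intro continuous_intros)
  then have cont_R: "continuous_on {0..1} R"
    using inv by (rule continuous_on_two_sided_inverse)
  \<comment> \<open>Stated for every \<open>L\<close> that commutes with \<open>E\<close>, because
    the logarithm must inherit all these commutations.\<close>
  have comm_R: "L * R t = R t * L" if "L * E = E * L" "t \<in> {0..1}" for L t
  proof (rule commutes_with_inverse)
    show "L * P t = P t * L"
      using that(1) by (simp add: P_def distrib_left distrib_right)
  qed (use that inv in auto)

  define F where "F t = integral {0..t} (\<lambda>u. E * R u)" for t
  have cont: "continuous_on {0..1} (\<lambda>u. E * R u)"
    by (intro continuous_intros cont_R)
  then have integrable: "(\<lambda>u. E * R u) integrable_on {0..t}" if "t \<in> {0..1}" for t
    using that by (intro integrable_continuous_real) (auto intro: continuous_on_subset)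
  have deriv_F: "(F has_vector_derivative E * R t) (at t within {0..1})" if "t \<in> {0..1}" for t
    unfolding F_def using integral_has_vector_derivative[OF cont that] .
  have comm_F: "L * F t = F t * L" if L: "L * E = E * L" and t: "t \<in> {0..1}" for L t
  proof -
    have "L * F t = integral {0..t} (\<lambda>u. L * (E * R u))"
      using integral_linear[OF integrable[OF t] bounded_linear_mult_right[of L]]
      by (simp add: F_def o_def)
    also have "\<dots> = integral {0..t} (\<lambda>u. E * R u * L)"
    proof (rule integral_cong)
      fix u assume "u \<in> {0..t}"
      then have "L * R u = R u * L" using t by (intro comm_R[OF L]) auto
      then show "L * (E * R u) = E * R u * L"
        by (metis L mult.assoc)
    qed
    also have "\<dots> = F t * L"
      using integral_linear[OF integrable[OF t] bounded_linear_mult_left[of L]]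
      by (simp add: F_def o_def)
    finally show ?thesis .
  qed
  have comm_EF: "E * F t = F t * E" if "t \<in> {0..1}" for t
    using comm_F[OF refl that] .
  \<comment> \<open>\<open>F s\<close> commutes with \<open>E\<close>, so it can itself take the
    place of \<open>L\<close> in \<open>comm_F\<close>.\<close>
  have comm_FF: "F s * F t = F t * F s" if "s \<in> {0..1}" "t \<in> {0..1}" for s t
    using comm_F[OF comm_EF[OF that(1), symmetric] that(2)] .

  have "((\<lambda>t. P t * exp (- F t)) has_vector_derivative 0) (at t within {0..1})"
    if t: "t \<in> {0..1}" for t
  proof -
    have "(P has_vector_derivative E) (at t within {0..1})"
      unfolding P_def by (auto intro!: derivative_eq_intros)
    moreover have "((\<lambda>t. exp (- F t)) has_vector_derivative exp (- F t) * - (E * R t))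
        (at t within {0..1})"
      using comm_FF t
      by (intro has_vector_derivative_exp_commuting has_vector_derivative_minus deriv_F) auto
    ultimately have "((\<lambda>t. P t * exp (- F t)) has_vector_derivative
        P t * (exp (- F t) * - (E * R t)) + E * exp (- F t)) (at t within {0..1})"
      by (rule has_vector_derivative_mult)
    \<comment> \<open>All factors commute, so \<open>P t\<close> meets its inverse
      \<open>R t\<close> and the two products cancel.\<close>
    moreover have "P t * (exp (- F t) * - (E * R t)) + E * exp (- F t) = 0"
    proof -
      have comm_exp: "E * exp (- F t) = exp (- F t) * E"
        using comm_EF[OF t] by (intro commutes_with_exp) simp
      have "P t * (exp (- F t) * (E * R t)) = P t * exp (- F t) * (R t * E)"
        using comm_R[OF refl t] by (simp add: mult.assoc)
      also have "P t * exp (- F t) = exp (- F t) * P t"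
        using comm_exp by (simp add: P_def distrib_left distrib_right)
      also have "\<dots> * (R t * E) = exp (- F t) * E"
        using inv(2)[OF t] by (metis mult.assoc mult_1_left)
      finally show ?thesis using comm_exp by simp
    qed
    ultimately show ?thesis by simp
  qed
  from has_vector_derivative_zero_constant[OF convex_real_interval(5) this]
  obtain C where "P t * exp (- F t) = C" if "t \<in> {0..1}" for t by blast
  then have "P 1 * exp (- F 1) = P 0 * exp (- F 0)" by simp
  then have "(1 + E) * exp (- F 1) = 1" by (simp add: P_def F_def)
  \<comment> \<open>The double negation matches the shape of \<open>exp_minus_inverse\<close> at
    \<open>- F 1\<close>.\<close>
  then have "(1 + E) * (exp (- F 1) * exp (- (- F 1))) = exp (F 1)"
    by (simp flip: mult.assoc)
  then have exp: "exp (F 1) = 1 + E" unfolding exp_minus_inverse by simp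

  have "\<bar>Im c\<bar> < pi" if c: "c \<in> eigenvalues (F 1)" for c
  proof -
    obtain Z where Z: "Z \<noteq> 0" "complexify (F 1) Z = complex_scale c Z"
      using c by (rule eigenvaluesE)
    \<comment> \<open>\<open>E\<close> preserves the eigenspace of \<open>F 1\<close> for
      \<open>c\<close>, hence has an eigenvector in it.\<close>
    obtain e W where W: "W \<noteq> 0" "complexify (F 1) W = complex_scale c W"
      "complexify E W = complex_scale e W"
    proof -
      let ?S = "{Z. complexify (F 1) Z = complex_scale c Z}"
      have "complexify (F 1) (complexify E Z) = complexify E (complexify (F 1) Z)" for Z
        using comm_EF[of 1] by (simp flip: complexify_mult)
      then have "complexify E Z - complex_scale d Z \<in> ?S" if "Z \<in> ?S" for d Z
        using that by (simp add: complexify_right complexify_complex_scale complex_scale_simps)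
          (simp add: mult.commute flip: complex_scale_simps(8))
      from eigenvector_in_invariant_set[OF _ Z(1) this] Z(2) show thesis
        using that by blast
    qed
    then have e: "cmod e < 1" using small[of e] unfolding eigenvalues_iff by blast
    \<comment> \<open>The segment from 1 to \<open>1 + e\<close> stays in the right half-plane,
      where \<open>Ln\<close> is differentiable and provides the antiderivative.\<close>
    have pos: "Re (1 + complex_of_real t * e) > 0" if "t \<in> {0..1}" for t
    proof -
      have "\<bar>t * Re e\<bar> \<le> 1 * \<bar>Re e\<bar>"
        using that unfolding abs_mult by (intro mult_right_mono) auto
      then show ?thesis using e abs_Re_le_cmod[of e] by simp
    qed
    have nonzero: "1 + complex_of_real t * e \<noteq> 0" if "t \<in> {0..1}" for t
      using pos[OF that] by (metis less_irrefl zero_complex.sel(1))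
    have "((\<lambda>t. e / (1 + of_real t * e)) has_integral
        Ln (1 + of_real 1 * e) - Ln (1 + of_real 0 * e)) {0..1}"
    proof (rule fundamental_theorem_of_calculus)
      fix t :: real assume "t \<in> {0..1}"
      then have "1 + of_real t * e \<notin> \<real>\<^sub>\<le>\<^sub>0"
        using pos by (force simp: complex_nonpos_Reals_iff)
      then have "((\<lambda>z. Ln (1 + z * e)) has_field_derivative e / (1 + of_real t * e)) (at (of_real t))"
        by (auto intro!: derivative_eq_intros simp: divide_inverse mult.commute)
      then show "((\<lambda>t. Ln (1 + of_real t * e)) has_vector_derivative e / (1 + of_real t * e))
          (at t within {0..1})"
        by (rule has_vector_derivative_real_field)
    qed simp
    then have "((\<lambda>t. e / (1 + of_real t * e)) has_integral Ln (1 + e)) {0..1}" by simp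
    from has_integral_linear[OF this bounded_linear_complex_scale_left[of W]]
    have "((\<lambda>t. complex_scale (e / (1 + of_real t * e)) W) has_integral
        complex_scale (Ln (1 + e)) W) {0..1}"
      by (simp add: o_def)
    \<comment> \<open>On \<open>W\<close> the operator integrand acts as the scalar integrand just
      computed.\<close>
    moreover have "complexify (E * R t) W = complex_scale (e / (1 + of_real t * e)) W"
      if t: "t \<in> {0..1}" for t
    proof -
      have "complexify (P t) W = complex_scale (1 + of_real t * e) W"
        by (simp add: P_def complexify_simps complexify_one W complex_scale_simps
            complex_scale_of_real)
      then have "complex_scale (1 + of_real t * e) (complexify (R t) W) = complexify (R t * P t) W"
        by (simp add: complexify_mult complexify_complex_scale)
      also have "\<dots> = W" using inv t by (simp add: complexify_one)
      finally have "complexify (R t) W = complex_scale (1 / (1 + of_real t * e)) W"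
        using nonzero[OF t]
        by (metis complex_scale_simps(8,9) nonzero_divide_eq_eq)
      then show ?thesis
        by (simp add: complexify_mult complexify_complex_scale W flip: complex_scale_simps(8))
    qed
    ultimately have "((\<lambda>t. complexify (E * R t) W) has_integral complex_scale (Ln (1 + e)) W) {0..1}"
      by (subst has_integral_cong) auto
    moreover have "((\<lambda>t. complexify (E * R t) W) has_integral complexify (F 1) W) {0..1}"
      using has_integral_linear[OF integrable_integral[OF integrable[of 1]]
          bounded_linear_complexify_left[of W]]
      by (simp add: o_def F_def)
    ultimately have "complex_scale (Ln (1 + e)) W = complexify (F 1) W"
      by (rule has_integral_unique)
    then have "complex_scale (c - Ln (1 + e)) W = 0"
      using W(2) by (simp add: complex_scale_simps)
    then have "c = Ln (1 + e)" using W(1) by (simp add: complex_scale_eq_0_iff)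
    moreover have "\<bar>Im (Ln (1 + e))\<bar> < pi / 2"
      using pos[of 1] nonzero[of 1] by (subst Re_Ln_pos_lt) auto
    ultimately show ?thesis using pi_gt_zero by simp
  qed
  with that exp comm_F[of _ 1] show ?thesis by auto
qed

section \<open>Uniqueness of the logarithm\<close>

lemma complexify_exp_eigenvector:
  fixes M :: "'a::euclidean_space endo"
  assumes "complexify M Z = complex_scale c Z"
  shows "complexify (exp M) Z = complex_scale (exp c) Z"
proof -
  have pow: "complexify (M ^ n) Z = complex_scale (c ^ n) Z" for n
    by (induction n)
       (simp_all add: complexify_one complexify_mult complexify_complex_scale complex_scale_simps
        assms mult.commute[of c])
  have "(\<lambda>n. complexify (M ^ n /\<^sub>R fact n) Z) sums complexify (exp M) Z"
    by (rule bounded_linear.sums[OF bounded_linear_complexify_left exp_converges])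
  moreover have "(\<lambda>n. complex_scale (c ^ n /\<^sub>R fact n) Z) sums complex_scale (exp c) Z"
    by (rule bounded_linear.sums[OF bounded_linear_complex_scale_left exp_converges])
  ultimately show ?thesis
    by (simp add: complexify_simps complex_scale_simps pow sums_unique2)
qed

text \<open>Every term of the series from order two on applies \<open>M\<close> at least twice to
  \<open>Z\<close> and vanishes.\<close>

lemma complexify_exp_square_zero:
  fixes M :: "'a::euclidean_space endo"
  assumes "complexify M (complexify M Z) = 0"
  shows "complexify (exp M) Z = Z + complexify M Z"
proof -
  let ?f = "\<lambda>n. inverse (fact (n + 2)) *\<^sub>R M ^ (n + 2)"
  have "complexify (M ^ (n + 2)) Z = 0" for n
    by (simp add: power_add power2_eq_square complexify_mult assms complexify_right del: power_Suc
        add_2_eq_Suc')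
  then have "complexify (suminf ?f) Z = 0"
    using bounded_linear.suminf[OF bounded_linear_complexify_left[of Z]
        summable_ignore_initial_segment[OF summable_exp_generic[of M], of 2]]
    by (simp add: complexify_simps)
  then show ?thesis
    by (subst exp_first_two_terms) (simp add: complexify_simps complexify_one)
qed

text \<open>
  If \<open>D = Y - X\<close> were nonzero, the range of \<open>D\<close> would contain a common eigenvector \<open>D V\<close> of
  \<open>D\<close> and \<open>X\<close>. Its \<open>D\<close>-eigenvalue \<open>d\<close> satisfies \<open>exp d = 1\<close> and \<open>\<bar>Im d\<bar> < 2 * pi\<close>, so \<open>d = 0\<close> and
  \<open>V = exp D V = V + D V\<close>.
\<close>

lemma exp_inj_on_strip:
  fixes X Y :: "'a::euclidean_space endo"
  assumes comm: "X * Y = Y * X" and eq: "exp X = exp Y"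
    and X: "\<And>c. c \<in> eigenvalues X \<Longrightarrow> \<bar>Im c\<bar> < pi"
    and Y: "\<And>c. c \<in> eigenvalues Y \<Longrightarrow> \<bar>Im c\<bar> < pi"
  shows "X = Y"
proof (rule ccontr)
  assume "X \<noteq> Y"
  define D where "D = Y - X"
  have "exp (Y + (- X)) = exp Y * exp (- X)"
    using comm by (intro exp_add_commuting) simp
  then have exp_D: "exp D = 1"
    using exp_minus_inverse[of X] by (simp add: D_def eq)
  have comm_D: "D * X = X * D"
    using comm by (simp add: D_def algebra_simps)
  obtain x where "endo_apply X x \<noteq> endo_apply Y x"
    using endo_eqI \<open>X \<noteq> Y\<close> by blast
  then have nonzero: "complexify D (x, 0) \<noteq> 0"
    by (simp add: D_def complexify_def endo_apply_simps zero_prod_def)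
  let ?S = "range (complexify D)"
  have inv_D: "complexify D Z - complex_scale c Z \<in> ?S" if "Z \<in> ?S" for c Z
    using that by (auto simp flip: complexify_complex_scale complexify_right)
  have inv_X: "complexify X Z - complex_scale c Z \<in> ?S" if Z: "Z \<in> ?S" for c Z
  proof -
    obtain V where "Z = complexify D V" using Z by (rule imageE)
    then have "complexify X Z - complex_scale c Z
        = complexify D (complexify X V - complex_scale c V)"
      by (simp add: complexify_right complexify_complex_scale comm_D flip: complexify_mult)
    then show ?thesis by blast
  qed
  obtain d c W where W: "W \<in> ?S" "W \<noteq> 0" "complexify D W = complex_scale d W"
    "complexify X W = complex_scale c W"
    by (rule common_eigenvector_in_invariant_set[OF comm_D rangeI nonzero inv_D inv_X])
  \<comment> \<open>As \<open>Y = D + X\<close>, the vector \<open>W\<close> is also an eigenvector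
    of \<open>Y\<close>; this makes \<open>d\<close> a difference of eigenvalues of \<open>Y\<close>
    and \<open>X\<close>.\<close>
  have "complexify Y W = complexify D W + complexify X W"
    by (simp add: D_def complexify_simps)
  then have "complexify Y W = complex_scale (d + c) W"
    by (simp add: W complex_scale_simps)
  then have "d + c \<in> eigenvalues Y" "c \<in> eigenvalues X"
    unfolding eigenvalues_iff using W(2,4) by blast+
  then have strip: "\<bar>Im (d + c)\<bar> < pi" "\<bar>Im c\<bar> < pi"
    using X Y by blast+
  have "complex_scale (exp d - 1) W = 0"
    using complexify_exp_eigenvector[OF W(3)]
    by (simp add: exp_D complexify_one complex_scale_simps)
  then have "exp d = 1"
    using W(2) by (simp add: complex_scale_eq_0_iff)
  then obtain n :: int where n: "Re d = 0" "Im d = of_int (2 * n) * pi"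
    by (auto simp: exp_eq_1)
  have "\<bar>Im d\<bar> < 1 * (2 * pi)"
    using strip unfolding plus_complex.sel by arith
  moreover have "\<bar>Im d\<bar> = \<bar>real_of_int n\<bar> * (2 * pi)"
    by (simp add: n(2) abs_mult)
  ultimately have "\<bar>real_of_int n\<bar> < 1"
    by (simp only: mult_less_cancel_right) (use pi_gt_zero in linarith)
  then have "n = 0" by linarith
  with n have "d = 0" by (simp add: complex_eq_iff)
  obtain V where V: "W = complexify D V" using W(1) by blast
  have "complexify (exp D) V = V + W"
    using W(3) \<open>d = 0\<close> unfolding V
    by (intro complexify_exp_square_zero) (simp add: complex_scale_simps)
  with W(2) show False by (simp add: exp_D complexify_one)
qed

text \<open>A competing logarithm \<open>Y\<close> commutes with \<open>M = exp Y\<close>, hence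
  with the constructed \<open>X\<close>, so that injectivity on the strip applies and
  \<open>THE\<close> picks \<open>X\<close>.\<close>

lemma
  fixes M :: "'a::euclidean_space endo"
  assumes "spectral_radius (M - 1) < 1"
  shows exp_principal_log: "exp (principal_log M) = M"
    and principal_log_commutes: "L * M = M * L \<Longrightarrow> L * principal_log M = principal_log M * L"
proof -
  obtain X where X: "exp X = 1 + (M - 1)"
    "\<And>L. L * (M - 1) = (M - 1) * L \<Longrightarrow> L * X = X * L"
    "\<And>c. c \<in> eigenvalues X \<Longrightarrow> \<bar>Im c\<bar> < pi"
    using exists_principal_log eigenvalue_less_spectral_radius[OF assms] by blast
  have "principal_log M = X"
    unfolding principal_log_def
  proof (rule the_equality)
    fix Y assume Y: "exp Y = M \<and> (\<forall>c\<in>eigenvalues Y. \<bar>Im c\<bar> < pi)"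
    then have "Y * (M - 1) = (M - 1) * Y"
      using exp_times_arg_commute[of Y] by (simp add: algebra_simps)
    then have comm: "Y * X = X * Y" by (rule X(2))
    show "Y = X" by (rule exp_inj_on_strip[OF comm]) (use X(1,3) Y in auto)
  qed (use X(1,3) in auto)
  then show "exp (principal_log M) = M"
    "L * M = M * L \<Longrightarrow> L * principal_log M = principal_log M * L"
    using X(1) X(2)[of L] by (simp_all add: left_diff_distrib right_diff_distrib)
qed

subsection \<open>The scaling and squaring recursion\<close>

lemma exp_scaleR_power2:
  fixes x :: "'a::{real_normed_algebra_1, banach}"
  shows "exp (2 ^ s *\<^sub>R x) = exp x ^ (2 ^ s)"
proof (induction s)
  case (Suc s)
  have "exp (2 ^ Suc s *\<^sub>R x) = exp (2 ^ s *\<^sub>R x + 2 ^ s *\<^sub>R x)"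
    by (simp flip: scaleR_left.add)
  also have "\<dots> = exp (2 ^ s *\<^sub>R x) * exp (2 ^ s *\<^sub>R x)"
    by (rule exp_add_commuting) simp
  also have "\<dots> = exp x ^ (2 ^ Suc s)"
    by (simp add: Suc.IH mult_2 power_add)
  finally show ?case .
qed simp

lemma commutes_sum:
  fixes L :: "'a::semiring_0"
  assumes "\<And>i. i \<in> I \<Longrightarrow> L * f i = f i * L"
  shows "L * sum f I = sum f I * L"
  using assms by (simp add: sum_distrib_left sum_distrib_right)

lemma commutes_power: "L * M = M * L \<Longrightarrow> L * M ^ n = M ^ n * (L :: 'a::monoid_mult)"
  by (metis power_commuting_commutes)

lemma commutes_mult:
  "L * M = M * L \<Longrightarrow> L * N = N * L \<Longrightarrow> L * (M * N) = M * N * (L :: 'a::semigroup_mult)"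
  by (metis mult.assoc)

lemma T0_commutes: "L * T0 l m L = T0 l m L * L"
  unfolding T0_def by (intro commutes_sum) (simp add: power_commutes)

text \<open>Downward induction from \<open>l\<close>, the direction of the recursion: at
  \<open>l\<close> the product is the Taylor tail starting at order \<open>l\<close>, and each step
  prepends one term. Multiplying by \<open>L ^ i\<close> instead of dividing keeps the identity free
  of inverses.\<close>

lemma power_mult_T_init:
  assumes "i \<le> l"
  shows "L ^ i * T_init l m L i = T0 l m L - (\<Sum>j<i. L ^ j /\<^sub>R fact j)"
  using assms
proof (induction rule: inc_induct)
  case base
  have "(\<Sum>k\<le>m. L ^ (k + l) /\<^sub>R fact (k + l)) = (\<Sum>k=l..m + l. L ^ k /\<^sub>R fact k)"
    using sum.shift_bounds_cl_nat_ivl[of "\<lambda>k. L ^ k /\<^sub>R fact k" 0 l m]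
    by (simp add: atMost_atLeast0)
  moreover have "{..m + l} = {..<l} \<union> {l..m + l}" by auto
  then have "T0 l m L = (\<Sum>j<l. L ^ j /\<^sub>R fact j) + (\<Sum>k=l..m + l. L ^ k /\<^sub>R fact k)"
    unfolding T0_def by (simp only:) (rule sum.union_disjoint; auto)
  ultimately show ?case
    by (subst T_init.simps) (simp add: sum_distrib_left add.commute flip: power_add)
next
  case (step i)
  have "L ^ i * T_init l m L i = L ^ Suc i * T_init l m L (Suc i) + L ^ i /\<^sub>R fact i"
    using step by (subst T_init.simps) (simp add: distrib_left power_Suc2 mult.assoc del: power_Suc)
  with step show ?case by simp
qed

text \<open>The index pairs with \<open>a + r < i\<close> are grouped by their sum \<open>n\<close>;
  each group is the binomial expansion of \<open>(N + N) ^ n\<close> over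
  \<open>fact n\<close>.\<close>

lemma exp_partial_sums_convolution:
  fixes N :: "'a::{real_normed_algebra_1, banach}"
  shows "(\<Sum>a<i. N ^ a /\<^sub>R fact a * (\<Sum>r<i - a. N ^ r /\<^sub>R fact r))
    = (\<Sum>n<i. (2 *\<^sub>R N) ^ n /\<^sub>R fact n)"
proof -
  let ?S = "\<lambda>n. N ^ n /\<^sub>R fact n"
  have "(\<Sum>a<i. ?S a * (\<Sum>r<i - a. ?S r)) = (\<Sum>(a, r)\<in>(SIGMA a:{..<i}. {..<i - a}). ?S a * ?S r)"
    unfolding sum_distrib_left by (rule sum.Sigma) auto
  also have "(SIGMA a:{..<i}. {..<i - a}) = {(a, r). a + r < i}" by auto
  also have "(\<Sum>(a, r)\<in>\<dots>. ?S a * ?S r) = (\<Sum>n<i. \<Sum>a\<le>n. ?S a * ?S (n - a))"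
    by (rule sum.triangle_reindex)
  also have "\<dots> = (\<Sum>n<i. (2 *\<^sub>R N) ^ n /\<^sub>R fact n)"
    using exp_series_add_commuting[of N N] by (simp add: scaleR_2)
  finally show ?thesis .
qed

text \<open>One doubling replaces \<open>N\<close> by \<open>2 N\<close> and \<open>P\<close> by its
  square. Writing \<open>e\<close> for the truncated exponential of \<open>N\<close>, the first
  summand contributes \<open>P * P - e * P\<close> and the sum over \<open>j\<close> contributes
  \<open>e * P\<close> minus the truncated exponential of \<open>2 N\<close>.\<close>

lemma scaling_and_squaring_step:
  fixes N P :: "'a::{real_normed_algebra_1, banach}"
  assumes comm: "P * N = N * P" and "i \<ge> 1"
    and T: "\<And>j. 1 \<le> j \<Longrightarrow> j \<le> i \<Longrightarrow> N ^ j * T j = P - (\<Sum>r<j. N ^ r /\<^sub>R fact r)"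
  shows "(2 *\<^sub>R N) ^ i * ((P * T i + (\<Sum>j = 1..i. T j /\<^sub>R fact (i - j))) /\<^sub>R 2 ^ i)
    = P * P - (\<Sum>r<i. (2 *\<^sub>R N) ^ r /\<^sub>R fact r)"
proof -
  let ?e = "\<lambda>j. \<Sum>r<j. N ^ r /\<^sub>R fact r"
  have "(\<Sum>j = 1..i. N ^ i * T j /\<^sub>R fact (i - j))
      = (\<Sum>j = 1..i. N ^ (i - j) /\<^sub>R fact (i - j) * (P - ?e j))"
  proof (intro sum.cong refl)
    fix j assume j: "j \<in> {1..i}"
    then have "N ^ i * T j = N ^ (i - j) * (N ^ j * T j)"
      by (simp flip: mult.assoc power_add)
    with j show "N ^ i * T j /\<^sub>R fact (i - j) = N ^ (i - j) /\<^sub>R fact (i - j) * (P - ?e j)"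
      by (simp add: T)
  qed
  \<comment> \<open>The substitution \<open>a = i - j\<close> produces the convolution of partial
    sums.\<close>
  also have "\<dots> = (\<Sum>a<i. N ^ a /\<^sub>R fact a * (P - ?e (i - a)))"
    by (rule sum.reindex_bij_witness[of _ "\<lambda>a. i - a" "\<lambda>j. i - j"]) auto
  also have "\<dots> = ?e i * P - (\<Sum>r<i. (2 *\<^sub>R N) ^ r /\<^sub>R fact r)"
    by (simp add: right_diff_distrib sum_subtractf exp_partial_sums_convolution sum_distrib_right
        del: scaleR_left_diff_distrib scaleR_right_diff_distrib mult_scaleR_left mult_scaleR_right)
  finally have sum: "(\<Sum>j = 1..i. N ^ i * T j /\<^sub>R fact (i - j))
      = ?e i * P - (\<Sum>r<i. (2 *\<^sub>R N) ^ r /\<^sub>R fact r)" .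
  have "N ^ i * (P * T i) = P * (N ^ i * T i)"
    using commutes_power[OF comm] by (metis mult.assoc)
  also have "\<dots> = P * P - ?e i * P"
    using comm commutes_sum[of "{..<i}" P "\<lambda>r. N ^ r /\<^sub>R fact r"] \<open>i \<ge> 1\<close>
    by (simp add: T right_diff_distrib commutes_power)
  finally have "N ^ i * (P * T i + (\<Sum>j = 1..i. T j /\<^sub>R fact (i - j)))
      = P * P - (\<Sum>r<i. (2 *\<^sub>R N) ^ r /\<^sub>R fact r)"
    using sum by (simp add: distrib_left sum_distrib_left)
  then show ?thesis by (simp add: scaleR_power)
qed

text \<open>Doubling step with \<open>N = 2 ^ k L\<close> and \<open>P = T0 ^ (2 ^ k)\<close>;
  \<open>i\<close> is generalized because a new operator uses all earlier ones with index up to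
  \<open>i\<close>.\<close>

lemma power_mult_T_rec:
  assumes "1 \<le> i" "i \<le> l"
  shows "(2 ^ k *\<^sub>R L) ^ i * T_rec l m L k i
    = T0 l m L ^ (2 ^ k) - (\<Sum>j<i. (2 ^ k *\<^sub>R L) ^ j /\<^sub>R fact j)"
  using assms
proof (induction k arbitrary: i)
  case 0
  then show ?case by (simp add: power_mult_T_init)
next
  case (Suc k)
  have "T0 l m L ^ 2 ^ k * (2 ^ k *\<^sub>R L) = 2 ^ k *\<^sub>R L * T0 l m L ^ 2 ^ k"
    using commutes_power[OF T0_commutes, of L l m] by simp
  then have "(2 *\<^sub>R 2 ^ k *\<^sub>R L) ^ i * T_rec l m L (Suc k) i
      = T0 l m L ^ 2 ^ k * T0 l m L ^ 2 ^ k - (\<Sum>j<i. (2 *\<^sub>R 2 ^ k *\<^sub>R L) ^ j /\<^sub>R fact j)"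
    unfolding T_rec.simps using Suc.prems
    by (intro scaling_and_squaring_step Suc.IH) auto
  moreover have "T0 l m L ^ 2 ^ Suc k = T0 l m L ^ 2 ^ k * T0 l m L ^ 2 ^ k"
    by (simp add: mult_2 power_add)
  ultimately show ?case by (simp only: scaleR_scaleR power_Suc[symmetric])
qed

text \<open>The scaled operator commutes with its \<open>h_log\<close>, so the exponential of their
  sum factors, and the factor \<open>exp (- ?N)\<close> inside the logarithm cancels, leaving
  \<open>T0\<close>. Scaling by \<open>2 ^ s\<close> becomes the power.\<close>

lemma exp_add_Delta:
  fixes L :: "'a::euclidean_space endo"
  assumes "spectral_radius (exp (- (L /\<^sub>R 2 ^ s)) * T0 l m (L /\<^sub>R 2 ^ s) - 1) < 1"
  shows "exp (L + Delta l m s L) = T0 l m (L /\<^sub>R 2 ^ s) ^ (2 ^ s)"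
proof -
  let ?N = "L /\<^sub>R 2 ^ s"
  let ?M = "exp (- ?N) * T0 l m ?N"
  have "?N * exp (- ?N) = exp (- ?N) * ?N"
    by (rule commutes_with_exp) simp
  then have "?N * ?M = ?M * ?N"
    using T0_commutes by (rule commutes_mult)
  then have "?N * h_log l m ?N = h_log l m ?N * ?N"
    unfolding h_log_def by (rule principal_log_commutes[OF assms])
  then have "exp (?N + h_log l m ?N) = exp ?N * exp (h_log l m ?N)"
    by (rule exp_add_commuting)
  also have "\<dots> = T0 l m ?N"
    unfolding h_log_def exp_principal_log[OF assms]
    by (simp add: exp_minus_inverse flip: mult.assoc)
  finally have "exp (2 ^ s *\<^sub>R (?N + h_log l m ?N)) = T0 l m ?N ^ (2 ^ s)"
    by (simp add: exp_scaleR_power2)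
  then show ?thesis by (simp add: Delta_def scaleR_add_right)
qed

lemma endo_inverse_power_left:
  fixes M :: "'a::euclidean_space endo"
  assumes "endo_invertible M"
  shows "endo_inverse M ^ n * M ^ n = 1"
proof (induction n)
  case (Suc n)
  have "endo_inverse M ^ Suc n * M ^ Suc n
      = endo_inverse M ^ n * (endo_inverse M * M) * M ^ n"
    by (simp only: power_Suc2[of "endo_inverse M"] power_Suc[of M] mult.assoc)
  then show ?case by (simp add: endo_inverse_left[OF assms] Suc)
qed simp

theorem theorem1:
  fixes A :: "real ^ 'n ^ 'n" and l m s :: nat
  assumes "l \<ge> 1"
    and "endo_invertible (lyapunov A)"
    and "lyapunov A /\<^sub>R 2 ^ s \<in> Omega l m"
  shows "T_output l m s (lyapunov A) =
    endo_inverse (lyapunov A) ^ l *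
      (exp (lyapunov A + Delta l m s (lyapunov A)) - (\<Sum>j<l. lyapunov A ^ j /\<^sub>R fact j))"
proof -
  let ?L = "lyapunov A"
  let ?N = "?L /\<^sub>R 2 ^ s"
  \<comment> \<open>At \<open>k = s\<close> the scaling is undone, so the identity for the recursion
    becomes one in \<open>?L\<close> itself.\<close>
  have "2 ^ s *\<^sub>R ?N = ?L" by simp
  then have "?L ^ l * T_output l m s ?L = T0 l m ?N ^ 2 ^ s - (\<Sum>j<l. ?L ^ j /\<^sub>R fact j)"
    using power_mult_T_rec[OF assms(1) order_refl, of s ?N m] by (simp only: T_output_def)
  moreover have "spectral_radius (exp (- ?N) * T0 l m ?N - 1) < 1"
    using assms(3) unfolding Omega_def by blast
  then have "exp (?L + Delta l m s ?L) = T0 l m ?N ^ 2 ^ s"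
    by (rule exp_add_Delta)
  \<comment> \<open>Invertibility enters here and removes the factor \<open>?L ^ l\<close>.\<close>
  moreover have "endo_inverse ?L ^ l * (?L ^ l * T_output l m s ?L) = T_output l m s ?L"
    by (simp only: mult.assoc[symmetric] endo_inverse_power_left[OF assms(2)] mult_1_left)
  ultimately show ?thesis by simp
qed

end
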